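(* Let $\ell$ and $n$ be nonnegative integers and let $a,q$ be nonzero complex numbers such that no zero factor appears in any denominator occurring in the identity below. Then $$\sum_{k=0}^{n}(a;q^3)_k\,\frac{(q^{-n};q)_k\,(q^{n-\ell}a;q)_k}{(q;q)_k(\sqrt a;q)_k(-\sqrt a;q)_k(\sqrt{qa};q)_k(-\sqrt{qa};q)_k}\,q^k$$ $$=\frac{(q^{n-\ell}a;q)_\ell}{(q^{2n-\ell}a;q)_\ell}\sum_{i=0}^{\ell}a^{\frac{n+2i}{3}}\,q^{(\ell+2n-i)i}\,\frac{a-q^{2i-2n}}{a-q^{-2n}}\,\frac{(q^{-\ell};q)_i(q^{-n};q)_i(q^{-2n}/a;q)_i}{(q;q)_i(q^{1+\ell-2n}/a;q)_i(q^{n-i}a;q)_i}\cdot\frac{(q;q^3)_{\frac{n-i}{3}}(q^2;q^3)_{\frac{n-i}{3}}}{(qa;q^3)_{\frac{n-i}{3}}(q^2a;q^3)_{\frac{n-i}{3}}}\,\chi(n-i).$$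
   Context: For complex $x,q$ and an integer $m$, the $q$-shifted factorial is $(x;q)_m=\prod_{j=0}^{m-1}(1-xq^j)$ for $m>0$, $(x;q)_0=1$, and $(x;q)_m=1/\prod_{j=m}^{-1}(1-xq^j)$ for $m<0$; $(x;q^3)_m$ is the same with $q$ replaced by $q^3$. For an integer $N$, $\chi(N)=1$ if $3\mid N$ and $\chi(N)=0$ otherwise; a summand containing $\chi(n-i)=0$ is understood to be $0$, so only indices $i$ with $(n-i)/3\in\mathbb Z$ contribute (and then $(n+2i)/3\in\mathbb Z$). $\sqrt a$ and $\sqrt{qa}$ denote any fixed square roots of $a$ and $qa$. *)

theory Defs
  imports Complex_Main
begin

definition qpoch :: "complex \<Rightarrow> complex \<Rightarrow> int \<Rightarrow> complex" where
  "qpoch x q m =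
     (if m \<ge> 0 then (\<Prod>j\<in>{0..<m}. 1 - x * q powi j)
      else 1 / (\<Prod>j\<in>{m..<0}. 1 - x * q powi j))"

text \<open>
  For \<open>m < 0\<close> the symbol \<open>qpoch x q m\<close> is itself a reciprocal. The following predicate says that
  none of the factors of its denominator vanishes; it is vacuous for \<open>m \<ge> 0\<close>.
\<close>
definition qpoch_defined :: "complex \<Rightarrow> complex \<Rightarrow> int \<Rightarrow> bool" where
  "qpoch_defined x q m \<longleftrightarrow> (\<forall>j\<in>{m..<0}. 1 - x * q powi j \<noteq> 0)"

definition chi :: "int \<Rightarrow> complex" where
  "chi N = (if 3 dvd N then 1 else 0)"

end

theory Submission
  imports Defs "HOL-Analysis.Uncountable_Sets"
begin

text \<open>
  The denominator on the left is \<open>(q;q)\<^sub>k (a;q)\<^sub>2\<^sub>k\<close>. For \<open>\<ell> = 0\<close> the numerator contains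
  \<open>(b;q)\<^sub>k (a/b;q)\<^sub>k\<close> with \<open>b = q\<^bsup>-n\<^esup>\<close>, and a combination of the summands for \<open>b\<close> and \<open>b q\<^sup>3\<close> telescopes.
  Hence the sum \<open>S(n)\<close> obeys \<open>S(n) = r(n) S(n - 3)\<close>, and \<open>r(1) = r(2) = 0\<close> produces the factor \<open>\<chi>\<close>.
  For general \<open>\<ell>\<close>, put \<open>x = q\<^bsup>-n\<^esup>\<close> and \<open>c = q\<^bsup>-2n\<^esup>/a\<close>. The numerator \<open>(x;q)\<^sub>k (x/(c q\<^bsup>\<ell>\<^esup>);q)\<^sub>k\<close> is a
  combination of the products \<open>(x q\<^sup>i;q)\<^sub>k (x/(c q\<^sup>i);q)\<^sub>k\<close>, \<open>0 \<le> i \<le> \<ell>\<close>, with coefficients independent of \<open>k\<close>;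
  these satisfy a recurrence in \<open>\<ell>\<close> that amounts to the two \<open>q\<close>-Pascal rules. So the sum is a
  combination of the values \<open>S(n - i)\<close>. These steps divide by quantities that the hypotheses do
  not control. But the hypotheses force \<open>a \<noteq> 1\<close>, so for fixed \<open>a\<close> only countably many \<open>q\<close> are
  exceptional, and both sides are continuous in \<open>q\<close>.
\<close>

subsection \<open>Finite \<open>q\<close>-products\<close>

definition qprod :: "'a::comm_ring_1 \<Rightarrow> 'a \<Rightarrow> nat \<Rightarrow> 'a" where
  "qprod x q k = (\<Prod>j<k. 1 - x * q ^ j)"

lemma qprod_0 [simp]: "qprod x q 0 = 1"
  by (simp add: qprod_def)

lemma qprod_Suc: "qprod x q (Suc k) = qprod x q k * (1 - x * q ^ k)"
  by (simp add: qprod_def)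

lemma qprod_Suc_left: "qprod x q (Suc k) = (1 - x) * qprod (x * q) q k"
  by (simp add: qprod_def prod.lessThan_Suc_shift mult.assoc del: prod.lessThan_Suc)

lemma qprod_add: "qprod x q (m + n) = qprod x q m * qprod (x * q ^ m) q n"
  by (induction n) (simp_all add: qprod_Suc power_add mult_ac)

lemma qprod_eq_0_iff:
  fixes x q :: "'a::idom"
  shows "qprod x q k = 0 \<longleftrightarrow> (\<exists>j<k. x * q ^ j = 1)"
  by (auto simp: qprod_def)

lemma qprod_mult_uminus: "qprod x q k * qprod (- x) q k = qprod (x ^ 2) (q ^ 2) k"
  unfolding qprod_def prod.distrib [symmetric]
  by (rule prod.cong) (simp_all add: algebra_simps power2_eq_square power_mult_distrib)

lemma qprod_even_odd: "qprod x (q ^ 2) k * qprod (q * x) (q ^ 2) k = qprod x q (2 * k)"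
proof (induction k)
  case (Suc k)
  have "qprod x (q ^ 2) (Suc k) * qprod (q * x) (q ^ 2) (Suc k)
      = qprod x (q ^ 2) k * qprod (q * x) (q ^ 2) k
        * ((1 - x * q ^ (2 * k)) * (1 - x * q ^ Suc (2 * k)))"
    by (simp add: qprod_Suc mult_ac flip: power_mult)
  then show ?case
    unfolding Suc.IH by (simp add: qprod_Suc mult.assoc)
qed simp

lemma qprod_square_roots:
  assumes "s ^ 2 = x" "t ^ 2 = q * x"
  shows "qprod s q k * qprod (- s) q k * qprod t q k * qprod (- t) q k = qprod x q (2 * k)"
  unfolding mult.assoc[of _ "qprod t q k"] qprod_mult_uminus assms by (rule qprod_even_odd)

lemma qpoch_of_nat: "qpoch x q (int k) = qprod x q k"
proof -
  have "qpoch x q (int k) = (\<Prod>j\<in>int ` {..<k}. 1 - x * q powi j)"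
    by (simp add: qpoch_def image_int_atLeastLessThan flip: atLeast0LessThan)
  also have "\<dots> = qprod x q k"
    by (subst prod.reindex) (auto simp: qprod_def)
  finally show ?thesis .
qed

lemma qprod_inverse_power_eq_0:
  fixes q :: "'a::field"
  assumes "q \<noteq> 0" "n < k"
  shows "qprod (1 / q ^ n) q k = 0"
  unfolding qprod_eq_0_iff using assms by (intro exI[of _ n]) simp

lemma prod_diff_eq_qprod:
  fixes x c q :: "'a::field"
  assumes "c \<noteq> 0" "q \<noteq> 0"
  shows "(\<Prod>j\<in>{0<..n}. x - c * q ^ j)
    = (\<Prod>j\<in>{0<..n}. - (c * q ^ j)) * qprod (x / (c * q ^ n)) q n"
proof (induction n)
  case (Suc n)
  have "qprod (x / (c * q ^ Suc n)) q (Suc n)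
      = (1 - x / (c * q ^ Suc n)) * qprod (x / (c * q ^ n)) q n"
    using assms by (simp add: qprod_Suc_left)
  moreover have "{0<..Suc n} = insert (Suc n) {0<..n}" by auto
  moreover have "x - c * q ^ Suc n = - (c * q ^ Suc n) * (1 - x / (c * q ^ Suc n))"
    using assms by (simp add: field_simps)
  ultimately show ?case using Suc.IH by (simp add: mult_ac)
qed simp

lemma qprod_quotient_eq_prod_diff:
  fixes x c q :: "'a::field"
  assumes "c \<noteq> 0" "q \<noteq> 0"
  shows "qprod (x / (c * q ^ n)) q n / qprod (1 / (c * q ^ n)) q n
    = (\<Prod>j\<in>{0<..n}. x - c * q ^ j) / qprod (c * q) q n"
proof -
  have "qprod (c * q) q n = (\<Prod>j\<in>{0<..n}. 1 - c * q ^ j)"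
    by (simp add: qprod_def prod.atLeast1_atMost_eq mult.assoc
        flip: atLeastSucAtMost_greaterThanAtMost)
  moreover have "(\<Prod>j\<in>{0<..n}. - (c * q ^ j)) \<noteq> 0"
    using assms by simp
  ultimately show ?thesis
    unfolding prod_diff_eq_qprod[OF assms] using assms by simp
qed

lemma prod_neg_powers:
  fixes c q :: "'a::field"
  assumes "q \<noteq> 0" "i \<le> l"
  shows "(\<Prod>j\<in>{0<..i}. - (c * q ^ j)) * (\<Prod>j<i. - (q ^ j / q ^ l)) = c ^ i / q ^ ((l - i) * i)"
proof -
  have "(\<Prod>j\<in>{0<..i}. - (c * q ^ j)) * (\<Prod>j<i. - (q ^ j / q ^ l))
      = (\<Prod>j<i. c * (q ^ j * q ^ Suc j) / q ^ l)"
    by (simp add: prod.atLeast1_atMost_eq mult_ac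
        flip: prod.distrib atLeastSucAtMost_greaterThanAtMost)
  moreover have "(\<Prod>j<i. q ^ j * q ^ Suc j) = q ^ (i * i)"
    by (induction i) (simp_all add: power_add mult_ac)
  moreover have "l * i = i * i + (l - i) * i"
    using assms(2) by (simp flip: add_mult_distrib)
  ultimately show ?thesis
    using assms(1) by (simp add: prod.distrib prod_dividef power_add flip: power_mult)
qed

lemma qprod_pair_contiguous:
  "(1 - d) * (qprod (d * y) q k * qprod y q k)
   = (1 - d * y) * (qprod (d * y * q) q k * qprod y q k)
     + d * (y - 1) * (qprod (d * y) q k * qprod (y * q) q k)"
proof -
  have shift: "(1 - z) * qprod (z * q) q k = qprod z q k * (1 - z * q ^ k)" for z
    by (simp flip: qprod_Suc qprod_Suc_left)
  have "(1 - d * y) * (qprod (d * y * q) q k * qprod y q k)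
        + d * (y - 1) * (qprod (d * y) q k * qprod (y * q) q k)
      = (1 - d * y) * qprod (d * y * q) q k * qprod y q k
        - d * qprod (d * y) q k * ((1 - y) * qprod (y * q) q k)"
    by (simp add: algebra_simps)
  also have "\<dots> = (1 - d) * (qprod (d * y) q k * qprod y q k)"
    unfolding shift by (simp add: algebra_simps)
  finally show ?thesis ..
qed

subsection \<open>Gaussian binomial coefficients\<close>

fun gauss_binomial :: "'a::comm_ring_1 \<Rightarrow> nat \<Rightarrow> nat \<Rightarrow> 'a" where
  "gauss_binomial q n 0 = 1"
| "gauss_binomial q 0 (Suc k) = 0"
| "gauss_binomial q (Suc n) (Suc k) = q ^ Suc k * gauss_binomial q n (Suc k) + gauss_binomial q n k"

lemma gauss_binomial_eq_0: "n < k \<Longrightarrow> gauss_binomial q n k = 0"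
  by (induction q n k rule: gauss_binomial.induct) auto

lemma gauss_binomial_absorption:
  "(1 - q ^ Suc k) * gauss_binomial q n (Suc k) = (1 - q ^ (n - k)) * gauss_binomial q n k"
proof (induction n arbitrary: k)
  case 0
  then show ?case by simp
next
  case (Suc n)
  show ?case
  proof (cases "k \<le> n")
    case True
    have "(1 - q ^ Suc k) * gauss_binomial q (Suc n) (Suc k)
        = q ^ Suc k * ((1 - q ^ Suc k) * gauss_binomial q n (Suc k))
          + (1 - q ^ Suc k) * gauss_binomial q n k"
      by (simp add: algebra_simps)
    also have "\<dots> = (1 - q ^ Suc k * q ^ (n - k)) * gauss_binomial q n k"
      unfolding Suc.IH by (simp add: algebra_simps)
    also have "q ^ Suc k * q ^ (n - k) = q ^ (Suc n - k) * q ^ k"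
      using True by (simp flip: power_add power_Suc)
    also have "(1 - q ^ (Suc n - k) * q ^ k) * gauss_binomial q n k
        = (1 - q ^ (Suc n - k)) * gauss_binomial q (Suc n) k"
    proof (cases k)
      case (Suc j)
      have "(1 - q ^ (Suc n - k) * q ^ k) * gauss_binomial q n k
          = (1 - q ^ (Suc n - k)) * q ^ k * gauss_binomial q n k
            + (1 - q ^ k) * gauss_binomial q n k"
        by (simp add: algebra_simps)
      also have "(1 - q ^ k) * gauss_binomial q n k = (1 - q ^ (Suc n - k)) * gauss_binomial q n j"
        using Suc.IH[of j] by (simp add: Suc)
      finally show ?thesis by (simp add: Suc distrib_left mult.assoc)
    qed simp
    finally show ?thesis .
  next
    case False
    then show ?thesis by (simp add: gauss_binomial_eq_0)
  qed
qed

lemma gauss_binomial_Suc_Suc':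
  "gauss_binomial q (Suc n) (Suc k) = gauss_binomial q n (Suc k) + q ^ (n - k) * gauss_binomial q n k"
  using gauss_binomial_absorption[of q k n] by (simp add: algebra_simps)

lemma gauss_binomial_Suc_Suc_mixed:
  assumes "k \<le> n"
  shows "(1 - c * q ^ Suc n) * gauss_binomial q (Suc n) (Suc k)
    = (1 - c * q ^ Suc (Suc k + n)) * gauss_binomial q n (Suc k)
      + q ^ (n - k) * (1 - c * q ^ Suc k) * gauss_binomial q n k"
proof -
  let ?g = "gauss_binomial q (Suc n) (Suc k)"
  have "(1 - c * q ^ Suc n) * ?g = ?g - c * q ^ Suc n * ?g"
    by (simp add: left_diff_distrib)
  also have "\<dots> = (gauss_binomial q n (Suc k) + q ^ (n - k) * gauss_binomial q n k)
      - c * q ^ Suc n * (q ^ Suc k * gauss_binomial q n (Suc k) + gauss_binomial q n k)"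
    by (metis gauss_binomial_Suc_Suc' gauss_binomial.simps(3))
  also have "\<dots> = (1 - c * (q ^ Suc n * q ^ Suc k)) * gauss_binomial q n (Suc k)
      + (q ^ (n - k) - c * q ^ Suc n) * gauss_binomial q n k"
    by (simp add: algebra_simps)
  also have "q ^ Suc n * q ^ Suc k = q ^ Suc (Suc k + n)"
    by (simp add: power_add mult_ac)
  also have "q ^ (n - k) - c * q ^ Suc n = q ^ (n - k) * (1 - c * q ^ Suc k)"
  proof -
    have "q ^ Suc n = q ^ (n - k) * q ^ Suc k"
      using assms by (simp flip: power_add power_Suc)
    then show ?thesis by (simp only: right_diff_distrib mult_1_right mult.left_commute)
  qed
  finally show ?thesis .
qed

lemma qprod_inverse_power_eq_gauss_binomial:
  fixes q :: "'a::field"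
  assumes "q \<noteq> 0" "i \<le> n"
  shows "qprod (1 / q ^ n) q i = (\<Prod>j<i. - (q ^ j / q ^ n)) * gauss_binomial q n i * qprod q q i"
  using \<open>i \<le> n\<close>
proof (induction i)
  case (Suc i)
  have "1 - q ^ i / q ^ n = - (q ^ i / q ^ n) * (1 - q ^ (n - i))"
    using assms(1) Suc.prems by (simp add: power_diff field_simps)
  then have "qprod (1 / q ^ n) q (Suc i)
      = (\<Prod>j<Suc i. - (q ^ j / q ^ n)) * ((1 - q ^ (n - i)) * gauss_binomial q n i) * qprod q q i"
    using Suc by (simp add: qprod_Suc)
  then show ?case
    unfolding gauss_binomial_absorption [symmetric] by (simp add: qprod_Suc mult_ac)
qed simp

subsection \<open>Expansion of a product of two \<open>q\<close>-products\<close>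

definition pair_expansion_coeff :: "'a::field \<Rightarrow> 'a \<Rightarrow> 'a \<Rightarrow> nat \<Rightarrow> nat \<Rightarrow> 'a" where
  "pair_expansion_coeff q x c l i =
     gauss_binomial q l i * ((1 - c * q ^ (2 * i)) / qprod (c * q ^ i) q (Suc l))
     * qprod x q i * (\<Prod>j\<in>{i<..l}. x - c * q ^ j)"

lemma pair_expansion_coeff_Suc_0:
  assumes "c * q ^ Suc l \<noteq> 1"
  shows "(1 - c * q ^ Suc l) * pair_expansion_coeff q x c (Suc l) 0
    = (x - c * q ^ Suc l) * pair_expansion_coeff q x c l 0"
proof -
  have "{0<..Suc l} = insert (Suc l) {0<..l}" by auto
  moreover have "1 - c * q ^ Suc l \<noteq> 0" using assms by simp
  ultimately show ?thesis by (simp add: pair_expansion_coeff_def qprod_Suc[of c q "Suc l"])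
qed

lemma prod_diff_shift:
  fixes x c q :: "'a::comm_ring_1"
  shows "(\<Prod>j\<in>{i<..l}. x * q - c * q ^ 2 * q ^ j)
    = q ^ (l - i) * (\<Prod>j\<in>{Suc i<..Suc l}. x - c * q ^ j)"
proof -
  have "(\<Prod>j\<in>{i<..l}. x * q - c * q ^ 2 * q ^ j) = (\<Prod>j\<in>{i<..l}. q * (x - c * q ^ Suc j))"
    by (rule prod.cong) (simp_all add: algebra_simps power2_eq_square)
  also have "\<dots> = q ^ (l - i) * (\<Prod>j\<in>{Suc i<..Suc l}. x - c * q ^ j)"
    unfolding prod.distrib
    by (simp add: prod.atLeast_Suc_atMost_Suc_shift
        del: prod.cl_ivl_Suc flip: atLeastSucAtMost_greaterThanAtMost)
  finally show ?thesis .
qed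

lemma pair_expansion_coeff_Suc_Suc:
  assumes "\<And>j. c * q ^ j \<noteq> 1" "i \<le> l"
  shows "(1 - c * q ^ Suc l) * pair_expansion_coeff q x c (Suc l) (Suc i)
    = (x - c * q ^ Suc l) * pair_expansion_coeff q x c l (Suc i)
      + (1 - x) * pair_expansion_coeff q (x * q) (c * q ^ 2) l i"
proof -
  define w where "w = (1 - c * q ^ (2 * Suc i)) / qprod (c * q ^ Suc i) q (Suc (Suc l))"
  define z where "z = qprod x q (Suc i) * (\<Prod>j\<in>{Suc i<..Suc l}. x - c * q ^ j)"
  have nonzero: "1 - c * q ^ j \<noteq> 0" for j using assms(1)[of j] by simp
  have top: "pair_expansion_coeff q x c (Suc l) (Suc i) = gauss_binomial q (Suc l) (Suc i) * w * z"
    by (simp only: pair_expansion_coeff_def w_def z_def mult.assoc)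
  have left: "(x - c * q ^ Suc l) * pair_expansion_coeff q x c l (Suc i)
      = (1 - c * q ^ Suc (Suc i + l)) * gauss_binomial q l (Suc i) * w * z"
  proof (cases "i = l")
    case True
    then show ?thesis by (simp add: pair_expansion_coeff_def gauss_binomial_eq_0)
  next
    case False
    then have "{Suc i<..Suc l} = insert (Suc l) {Suc i<..l}" using assms(2) by auto
    moreover have "(1 - c * q ^ (2 * Suc i)) / qprod (c * q ^ Suc i) q (Suc l)
        = (1 - c * q ^ Suc (Suc i + l)) * w"
      using nonzero[of "Suc (Suc i + l)"]
      by (simp add: w_def qprod_Suc[of _ q "Suc l"] power_add mult_ac)
    ultimately show ?thesis by (simp add: pair_expansion_coeff_def z_def)
  qed
  have "(\<Prod>j\<in>{i<..l}. x * q - c * q ^ 2 * q ^ j)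
      = q ^ (l - i) * (\<Prod>j\<in>{Suc i<..Suc l}. x - c * q ^ j)"
    by (rule prod_diff_shift)
  moreover have "(1 - c * q ^ 2 * q ^ (2 * i)) / qprod (c * q ^ 2 * q ^ i) q (Suc l)
      = (1 - c * q ^ Suc i) * w"
    using nonzero[of "Suc i"]
    by (simp add: w_def qprod_Suc_left[of _ q "Suc l"] power2_eq_square mult_ac)
  ultimately have right: "(1 - x) * pair_expansion_coeff q (x * q) (c * q ^ 2) l i
      = q ^ (l - i) * (1 - c * q ^ Suc i) * gauss_binomial q l i * w * z"
    by (simp add: pair_expansion_coeff_def z_def qprod_Suc_left mult_ac)
  show ?thesis
    unfolding top left right gauss_binomial_Suc_Suc_mixed[OF assms(2), of c q, symmetric]
      mult.assoc [symmetric] distrib_right [symmetric] ..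
qed

lemma qprod_pair_expansion:
  assumes "q \<noteq> 0" "c \<noteq> 0" "\<And>j. c * q ^ j \<noteq> 1"
  shows "qprod x q k * qprod (x / (c * q ^ l)) q k
    = (\<Sum>i\<le>l. pair_expansion_coeff q x c l i
              * (qprod (x * q ^ i) q k * qprod (x / (c * q ^ i)) q k))"
  using assms(2,3)
proof (induction l arbitrary: x c)
  case 0
  then show ?case using 0(2)[of 0] by (simp add: pair_expansion_coeff_def qprod_Suc)
next
  case (Suc l)
  define pair where "pair i = qprod (x * q ^ i) q k * qprod (x / (c * q ^ i)) q k" for i
  define \<gamma> where "\<gamma> i = pair_expansion_coeff q x c l i" for i
  define \<delta> where "\<delta> i = pair_expansion_coeff q (x * q) (c * q ^ 2) l i" for i
  have prems: "c * q ^ 2 \<noteq> 0" "c * q ^ 2 * q ^ j \<noteq> 1" for j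
    using Suc.prems(1) Suc.prems(2)[of "2 + j"] assms(1)
    by (simp_all add: mult.assoc flip: power_add)
  have "(1 - c * q ^ Suc l) * (qprod x q k * qprod (x / (c * q ^ Suc l)) q k)
      = (x - c * q ^ Suc l) * (qprod x q k * qprod (x / (c * q ^ l)) q k)
        + (1 - x) * (qprod (x * q) q k * qprod (x * q / (c * q ^ 2 * q ^ l)) q k)"
    using qprod_pair_contiguous[of "c * q ^ Suc l" "x / (c * q ^ Suc l)" q k] Suc.prems(1) assms(1)
    by (simp add: right_diff_distrib power2_eq_square mult_ac)
  also have "qprod x q k * qprod (x / (c * q ^ l)) q k = (\<Sum>i\<le>Suc l. \<gamma> i * pair i)"
    unfolding pair_def \<gamma>_def Suc.IH[OF Suc.prems]
    by (simp add: pair_expansion_coeff_def gauss_binomial_eq_0)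
  also have "qprod (x * q) q k * qprod (x * q / (c * q ^ 2 * q ^ l)) q k
      = (\<Sum>i\<le>l. \<delta> i * pair (Suc i))"
    unfolding Suc.IH[OF prems] pair_def \<delta>_def
    using assms(1) by (simp add: power2_eq_square mult_ac)
  also have "(x - c * q ^ Suc l) * (\<Sum>i\<le>Suc l. \<gamma> i * pair i) + (1 - x) * (\<Sum>i\<le>l. \<delta> i * pair (Suc i))
      = (x - c * q ^ Suc l) * \<gamma> 0 * pair 0
        + (\<Sum>i\<le>l. ((x - c * q ^ Suc l) * \<gamma> (Suc i) + (1 - x) * \<delta> i) * pair (Suc i))"
    unfolding sum.atMost_Suc_shift
    by (simp add: sum_distrib_left distrib_left distrib_right sum.distrib mult_ac)
  also have "(\<Sum>i\<le>l. ((x - c * q ^ Suc l) * \<gamma> (Suc i) + (1 - x) * \<delta> i) * pair (Suc i))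
      = (\<Sum>i\<le>l. (1 - c * q ^ Suc l) * pair_expansion_coeff q x c (Suc l) (Suc i) * pair (Suc i))"
    unfolding \<gamma>_def \<delta>_def
    by (rule sum.cong) (simp_all only: atMost_iff pair_expansion_coeff_Suc_Suc[OF Suc.prems(2)])
  also have "(x - c * q ^ Suc l) * \<gamma> 0 * pair 0 + \<dots>
      = (1 - c * q ^ Suc l) * (\<Sum>i\<le>Suc l. pair_expansion_coeff q x c (Suc l) i * pair i)"
    unfolding sum.atMost_Suc_shift \<gamma>_def pair_expansion_coeff_Suc_0[OF Suc.prems(2), symmetric]
    by (simp only: distrib_left sum_distrib_left mult.assoc)
  finally show ?case
    unfolding pair_def using Suc.prems(2)[of "Suc l"] by simp
qed

lemma pair_expansion_coeff_eq:
  assumes "q \<noteq> 0" "c \<noteq> 0" and c: "\<And>j. c * q ^ j \<noteq> 1" and "i \<le> l"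
    and nonzero: "qprod q q i \<noteq> 0" "qprod (x / (c * q ^ i)) q i \<noteq> 0"
  shows "pair_expansion_coeff q x c l i
    = qprod (x / (c * q ^ l)) q l / qprod (1 / (c * q ^ l)) q l * (q ^ ((l - i) * i) / c ^ i)
      * ((1 - c * q ^ (2 * i)) / (1 - c))
      * ((qprod (1 / q ^ l) q i * qprod x q i * qprod c q i)
         / (qprod q q i * qprod (c * q ^ Suc l) q i * qprod (x / (c * q ^ i)) q i))"
proof -
  define s where "s = (\<Prod>j\<in>{0<..i}. - (c * q ^ j))"
  define p where "p = (\<Prod>j<i. - (q ^ j / q ^ l))"
  define w where "w = (\<Prod>j\<in>{i<..l}. x - c * q ^ j)"
  have "(\<Prod>j\<in>{0<..l}. x - c * q ^ j) = (\<Prod>j\<in>{0<..i}. x - c * q ^ j) * w"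
    unfolding w_def using \<open>i \<le> l\<close>
    by (subst prod.union_disjoint [symmetric]) (auto intro!: prod.cong)
  then have ratio: "qprod (x / (c * q ^ l)) q l / qprod (1 / (c * q ^ l)) q l
      = s * qprod (x / (c * q ^ i)) q i * w / qprod (c * q) q l"
    by (simp only: qprod_quotient_eq_prod_diff prod_diff_eq_qprod assms(1,2) s_def not_False_eq_True)
  have signs: "s * p * (q ^ ((l - i) * i) / c ^ i) = 1"
    using assms(1,2) by (simp add: s_def p_def prod_neg_powers \<open>i \<le> l\<close>)
  have "c * q ^ j * q ^ k \<noteq> 1" for j k
    using c[of "j + k"] by (simp add: power_add mult.assoc)
  then have "qprod (c * q ^ j) q k \<noteq> 0" for j k
    by (simp add: qprod_eq_0_iff)
  from this[of i "Suc l"] this[of 1 l] this[of "Suc l" i] c[of 0]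
  have quotient: "qprod c q i / ((1 - c) * qprod (c * q) q l * qprod (c * q ^ Suc l) q i)
      = 1 / qprod (c * q ^ i) q (Suc l)"
    using qprod_add[of c q i "Suc l"] qprod_add[of c q "Suc l" i]
    by (simp add: frac_eq_eq qprod_Suc_left[of c] add.commute)
  have "qprod (x / (c * q ^ l)) q l / qprod (1 / (c * q ^ l)) q l * (q ^ ((l - i) * i) / c ^ i)
      * ((1 - c * q ^ (2 * i)) / (1 - c))
      * ((qprod (1 / q ^ l) q i * qprod x q i * qprod c q i)
         / (qprod q q i * qprod (c * q ^ Suc l) q i * qprod (x / (c * q ^ i)) q i))
    = s * p * (q ^ ((l - i) * i) / c ^ i) * gauss_binomial q l i * (1 - c * q ^ (2 * i))
      * (qprod c q i / ((1 - c) * qprod (c * q) q l * qprod (c * q ^ Suc l) q i)) * qprod x q i * w"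
    unfolding ratio qprod_inverse_power_eq_gauss_binomial[OF \<open>q \<noteq> 0\<close> \<open>i \<le> l\<close>] p_def
    using nonzero by (simp add: mult_ac)
  then show ?thesis
    unfolding signs quotient by (simp add: pair_expansion_coeff_def w_def)
qed

subsection \<open>The cubic sum\<close>

definition cubic_weight :: "'a::field \<Rightarrow> 'a \<Rightarrow> nat \<Rightarrow> 'a" where
  "cubic_weight a q k = qprod a (q ^ 3) k * q ^ k / (qprod q q k * qprod a q (2 * k))"

text \<open>
  If \<open>a = b c q\<^sup>3\<close>, the two products in \<open>cubic_difference b c q k\<close> are, up to factors independent of \<open>k\<close>,
  \<open>(b;q)\<^sub>k (a/b;q)\<^sub>k\<close> and its image under \<open>b \<mapsto> b q\<^sup>3\<close>.
\<close>
definition cubic_difference :: "'a::comm_ring_1 \<Rightarrow> 'a \<Rightarrow> 'a \<Rightarrow> nat \<Rightarrow> 'a" where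
  "cubic_difference b c q k =
     b * qprod b q k * qprod c q (k + 3) - c * (1 - c) * qprod (b * q) q (k + 2) * qprod c q k"

lemma cubic_telescoping_identity:
  fixes b c q t :: "'a::field"
  shows "(b - c) * ((1 - t) * (1 - b * c * q * t ^ 2) * (1 - b * c * q ^ 2 * t ^ 2))
     + t * (b * (1 - b) * (1 - c * t) * (1 - c * q * t) * (1 - c * q ^ 2 * t)
            - c * (1 - c) * (1 - b * t) * (1 - b * q * t) * (1 - b * q ^ 2 * t))
     = (b - c) * (1 - b * c * q ^ 3 * t ^ 3) * (1 - b * t) * (1 - c * t)"
  by algebra

lemma cubic_difference_Suc:
  fixes b c q :: "'a::comm_ring_1"
  defines "t \<equiv> \<lambda>m. q ^ Suc m"
  shows "cubic_difference b c q (Suc m) = qprod (b * q) q m * qprod c q (Suc m)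
    * (b * (1 - b) * (1 - c * t m) * (1 - c * q * t m) * (1 - c * q ^ 2 * t m)
       - c * (1 - c) * (1 - b * t m) * (1 - b * q * t m) * (1 - b * q ^ 2 * t m))"
proof -
  have "qprod c q (Suc m + 3)
      = qprod c q (Suc m) * ((1 - c * t m) * (1 - c * q * t m) * (1 - c * q ^ 2 * t m))"
    by (simp add: t_def numeral_3_eq_3 qprod_Suc power2_eq_square mult_ac)
  moreover have "qprod (b * q) q (Suc m + 2)
      = qprod (b * q) q m * ((1 - b * t m) * (1 - b * q * t m) * (1 - b * q ^ 2 * t m))"
    by (simp add: t_def numeral_2_eq_2 qprod_Suc power2_eq_square mult_ac)
  ultimately show ?thesis
    unfolding cubic_difference_def qprod_Suc_left[of b q m]
      right_diff_distrib[of "qprod (b * q) q m * qprod c q (Suc m)"]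
    by (simp only: mult_ac)
qed

lemma sum_cubic_weight_difference:
  fixes b c q :: "'a::field"
  defines "a \<equiv> b * c * q ^ 3"
  assumes "qprod q q m \<noteq> 0" "qprod a q (2 * m) \<noteq> 0"
  shows "(\<Sum>k\<le>m. cubic_weight a q k * cubic_difference b c q k)
    = (b - c) * (qprod a (q ^ 3) (Suc m) / (qprod q q m * qprod a q (2 * m)))
      * (qprod (b * q) q m * qprod c q (Suc m))"
  using assms(2,3)
proof (induction m)
  case 0
  show ?case
    by (simp add: cubic_weight_def cubic_difference_def qprod_Suc a_def
        numeral_2_eq_2 numeral_3_eq_3) algebra
next
  case (Suc m)
  define t where "t = q ^ Suc m"
  define common where "common = qprod (b * q) q m * qprod c q (Suc m)"
  define w where "w = qprod a (q ^ 3) (Suc m) / (qprod q q (Suc m) * qprod a q (2 * Suc m))"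
  define r where "r = (1 - t) * (1 - b * c * q * t ^ 2) * (1 - b * c * q ^ 2 * t ^ 2)"
  have "qprod q q (Suc m) * qprod a q (2 * Suc m) = qprod q q m * qprod a q (2 * m) * r"
    by (simp add: qprod_Suc r_def t_def a_def power_mult power2_eq_square power3_eq_cube mult_ac)
  then have nonzero: "qprod q q m \<noteq> 0" "qprod a q (2 * m) \<noteq> 0"
    and weight: "qprod a (q ^ 3) (Suc m) / (qprod q q m * qprod a q (2 * m)) = w * r"
    using Suc.prems by (auto simp: w_def)
  have head: "(\<Sum>k\<le>m. cubic_weight a q k * cubic_difference b c q k) = w * common * ((b - c) * r)"
    unfolding Suc.IH[OF nonzero] weight common_def by (simp only: mult_ac)
  have last: "cubic_weight a q (Suc m) * cubic_difference b c q (Suc m)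
      = w * common * (t * (b * (1 - b) * (1 - c * t) * (1 - c * q * t) * (1 - c * q ^ 2 * t)
                           - c * (1 - c) * (1 - b * t) * (1 - b * q * t) * (1 - b * q ^ 2 * t)))"
    by (simp only: cubic_weight_def cubic_difference_Suc w_def common_def t_def)
      (simp add: mult_ac)
  have "qprod a (q ^ 3) (Suc (Suc m)) = qprod a (q ^ 3) (Suc m) * (1 - b * c * q ^ 3 * t ^ 3)"
    by (simp add: qprod_Suc[of _ _ "Suc m"] a_def t_def mult.commute flip: power_mult power_Suc)
  moreover have "qprod (b * q) q (Suc m) = qprod (b * q) q m * (1 - b * t)"
    "qprod c q (Suc (Suc m)) = qprod c q (Suc m) * (1 - c * t)"
    by (simp_all add: qprod_Suc t_def mult_ac)
  ultimately show ?case
    unfolding sum.atMost_Suc head last distrib_left [symmetric] cubic_telescoping_identity r_def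
    by (simp add: w_def common_def mult_ac)
qed

definition cubic_sum :: "nat \<Rightarrow> 'a::field \<Rightarrow> 'a \<Rightarrow> 'a \<Rightarrow> 'a" where
  "cubic_sum n a q b = (\<Sum>k\<le>n. cubic_weight a q k * (qprod b q k * qprod (a / b) q k))"

lemma cubic_sum_recurrence:
  fixes a b c q :: "'a::field"
  assumes "a = b * c * q ^ 3" "q \<noteq> 0" "b \<noteq> 0" "c \<noteq> 1"
    and "qprod q q n \<noteq> 0" "qprod a q (2 * n) \<noteq> 0" "qprod (b * q) q n = 0"
  shows "b * (1 - c * q) * (1 - c * q ^ 2) * cubic_sum n a q b
    = c * (1 - b * q) * (1 - b * q ^ 2) * cubic_sum n a q (b * q ^ 3)"
proof -
  have split_c: "qprod c q (k + 3) = (1 - c) * (1 - c * q) * (1 - c * q ^ 2) * qprod (a / b) q k"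
    and split_b: "qprod (b * q) q (k + 2) = (1 - b * q) * (1 - b * q ^ 2) * qprod (b * q ^ 3) q k"
    and c: "a / (b * q ^ 3) = c" for k
    using assms by (simp_all add: numeral_2_eq_2 numeral_3_eq_3 qprod_Suc_left mult_ac)
  have "(1 - c) * (b * (1 - c * q) * (1 - c * q ^ 2) * cubic_sum n a q b
      - c * (1 - b * q) * (1 - b * q ^ 2) * cubic_sum n a q (b * q ^ 3))
    = (\<Sum>k\<le>n. cubic_weight a q k * cubic_difference b c q k)"
    unfolding cubic_sum_def cubic_difference_def split_c split_b c
      sum_distrib_left sum_subtractf [symmetric]
    by (rule sum.cong) (simp_all add: algebra_simps)
  also have "\<dots> = 0"
    using sum_cubic_weight_difference[of q n b c] assms by simp
  finally show ?thesis using \<open>c \<noteq> 1\<close> by simp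
qed

definition cubic_sum_value :: "'a::field \<Rightarrow> 'a \<Rightarrow> nat \<Rightarrow> 'a" where
  "cubic_sum_value a q m =
     a ^ m * ((qprod q (q ^ 3) m * qprod (q ^ 2) (q ^ 3) m)
              / (qprod (q * a) (q ^ 3) m * qprod (q ^ 2 * a) (q ^ 3) m))"

lemma cubic_sum_value_Suc:
  "cubic_sum_value a q (Suc m)
   = a * ((1 - q ^ (3 * m + 1)) * (1 - q ^ (3 * m + 2)))
     / ((1 - a * q ^ (3 * m + 1)) * (1 - a * q ^ (3 * m + 2))) * cubic_sum_value a q m"
  by (simp add: cubic_sum_value_def qprod_Suc power_mult [symmetric] power2_eq_square mult_ac)

locale generic_parameters =
  fixes a q :: "'a::field"
  assumes q_nonzero: "q \<noteq> 0"
    and q_not_root_of_unity: "q ^ Suc k \<noteq> 1"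
    and a_not_power: "a * q powi j \<noteq> 1"
begin

lemma a_power_nonzero: "1 - a * q ^ j \<noteq> 0"
  using a_not_power[of "int j"] by simp

lemma qprod_nonzero: "qprod q q k \<noteq> 0" "qprod a q k \<noteq> 0"
  using q_not_root_of_unity a_not_power[of "int _"]
  by (auto simp: qprod_eq_0_iff simp flip: power_Suc)

lemma cubic_sum_1: "cubic_sum n a q 1 = 1"
proof -
  have "cubic_sum n a q 1 = (\<Sum>k\<le>n. if k = 0 then 1 else 0)"
    unfolding cubic_sum_def
    using q_nonzero qprod_inverse_power_eq_0[of q 0]
    by (intro sum.cong) (auto simp: cubic_weight_def)
  then show ?thesis by simp
qed

lemma cubic_sum_eq_0:
  assumes "p \<in> {1, 2}" "p \<le> n"
  shows "cubic_sum n a q (1 / q ^ p) = 0"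
proof -
  define b c where "b = 1 / q ^ p" and "c = a * q powi (int p - 3)"
  have vanishing: "(1 - b * q) * (1 - b * q ^ 2) = 0" "qprod (b * q) q n = 0"
    using assms q_nonzero qprod_inverse_power_eq_0[of q "p - 1" n]
    by (auto simp: b_def power2_eq_square)
  have "c * q ^ j = a * q powi (int p - 3 + int j)" for j
    by (simp add: c_def power_int_add q_nonzero)
  then have "c * q ^ j \<noteq> 1" for j by (simp add: a_not_power)
  from this[of 0] this[of 1] this[of 2] have c: "c \<noteq> 1" "c * q \<noteq> 1" "c * q ^ 2 \<noteq> 1"
    by simp_all
  have "a = b * c * q ^ 3" "b \<noteq> 0"
    by (simp_all add: b_def c_def power_int_diff q_nonzero)
  then have "b * (1 - c * q) * (1 - c * q ^ 2) * cubic_sum n a q b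
      = c * ((1 - b * q) * (1 - b * q ^ 2)) * cubic_sum n a q (b * q ^ 3)"
    using cubic_sum_recurrence[of a b c q n] vanishing c q_nonzero qprod_nonzero by simp
  then show ?thesis
    unfolding vanishing using c \<open>b \<noteq> 0\<close> q_nonzero by (simp add: b_def)
qed

lemma cubic_sum_step:
  assumes "p + 3 \<le> n"
  shows "cubic_sum n a q (1 / q ^ (p + 3))
    = a * ((1 - q ^ (p + 1)) * (1 - q ^ (p + 2))) / ((1 - a * q ^ (p + 1)) * (1 - a * q ^ (p + 2)))
      * cubic_sum n a q (1 / q ^ p)"
proof -
  define b c where "b = 1 / q ^ (p + 3)" and "c = a * q ^ p"
  have "b * q = 1 / q ^ (p + 2)"
    using q_nonzero by (simp add: b_def power_add power3_eq_cube power2_eq_square)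
  then have "qprod (b * q) q n = 0"
    using assms q_nonzero qprod_inverse_power_eq_0[of q "p + 2" n] by simp
  moreover have "a = b * c * q ^ 3" "b * q ^ 3 = 1 / q ^ p" "b \<noteq> 0" "c \<noteq> 1"
    using a_power_nonzero[of p] by (simp_all add: b_def c_def power_add q_nonzero)
  ultimately have recurrence: "b * (1 - c * q) * (1 - c * q ^ 2) * cubic_sum n a q b
      = c * (1 - b * q) * (1 - b * q ^ 2) * cubic_sum n a q (1 / q ^ p)"
    using cubic_sum_recurrence[of a b c q n] q_nonzero qprod_nonzero by simp
  have "b * ((1 - a * q ^ (p + 1)) * (1 - a * q ^ (p + 2)) * cubic_sum n a q b)
      = b * (1 - c * q) * (1 - c * q ^ 2) * cubic_sum n a q b"
    by (simp add: c_def power_add power2_eq_square mult_ac)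
  also note recurrence
  also have "c * (1 - b * q) * (1 - b * q ^ 2) = b * (a * ((1 - q ^ (p + 1)) * (1 - q ^ (p + 2))))"
    using q_nonzero by (simp add: b_def c_def field_simps power_add power2_eq_square power3_eq_cube)
  finally have "(1 - a * q ^ (p + 1)) * (1 - a * q ^ (p + 2)) * cubic_sum n a q b
      = a * ((1 - q ^ (p + 1)) * (1 - q ^ (p + 2))) * cubic_sum n a q (1 / q ^ p)"
    unfolding mult.assoc [of b] using \<open>b \<noteq> 0\<close> by simp
  then show ?thesis
    using a_power_nonzero[of "p + 1"] a_power_nonzero[of "p + 2"]
    by (simp add: b_def eq_divide_eq mult_ac)
qed

lemma cubic_sum_inverse_power:
  assumes "p \<le> n"
  shows "cubic_sum n a q (1 / q ^ p) = (if 3 dvd p then cubic_sum_value a q (p div 3) else 0)"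
proof -
  have "cubic_sum n a q (1 / q ^ (3 * m + r)) = (if r = 0 then cubic_sum_value a q m else 0)"
    if "r < 3" "3 * m + r \<le> n" for m r
    using that(2)
  proof (induction m)
    case 0
    have "r = 0 \<or> r = 1 \<or> r = 2" using \<open>r < 3\<close> by linarith
    then show ?case using 0 cubic_sum_eq_0[of r n] cubic_sum_1[of n]
      by (auto simp: cubic_sum_value_def)
  next
    case (Suc m)
    have shift: "3 * Suc m + r = 3 * m + r + 3" by simp
    show ?case
      using Suc cubic_sum_step[of "3 * m + r" n] unfolding shift
      by (cases "r = 0") (simp_all add: cubic_sum_value_Suc)
  qed
  from this[of "p mod 3" "p div 3"] show ?thesis
    using assms by (simp add: dvd_eq_mod_eq_0)
qed

end

subsection \<open>The shifted cubic sum for generic parameters\<close>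

definition shifted_cubic_sum :: "nat \<Rightarrow> nat \<Rightarrow> complex \<Rightarrow> complex \<Rightarrow> complex" where
  "shifted_cubic_sum n l a q =
     (\<Sum>k\<le>n. cubic_weight a q k
             * (qprod (1 / q ^ n) q k * qprod (q powi (int n - int l) * a) q k))"

definition shifted_cubic_term :: "nat \<Rightarrow> nat \<Rightarrow> complex \<Rightarrow> complex \<Rightarrow> nat \<Rightarrow> complex" where
  "shifted_cubic_term n l a q i =
     a powi ((int n + 2 * int i) div 3)
     * q powi ((int l + 2 * int n - int i) * int i)
     * ((a - q powi (2 * int i - 2 * int n)) / (a - q powi (- 2 * int n)))
     * ((qpoch (q powi (- int l)) q (int i) * qpoch (q powi (- int n)) q (int i)
         * qpoch (q powi (- 2 * int n) / a) q (int i))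
        / (qpoch q q (int i) * qpoch (q powi (1 + int l - 2 * int n) / a) q (int i)
           * qpoch (q powi (int n - int i) * a) q (int i)))
     * ((qpoch q (q ^ 3) ((int n - int i) div 3)
         * qpoch (q ^ 2) (q ^ 3) ((int n - int i) div 3))
        / (qpoch (q * a) (q ^ 3) ((int n - int i) div 3)
           * qpoch (q ^ 2 * a) (q ^ 3) ((int n - int i) div 3)))
     * chi (int n - int i)"

definition shifted_cubic_prefactor :: "nat \<Rightarrow> nat \<Rightarrow> complex \<Rightarrow> complex \<Rightarrow> complex" where
  "shifted_cubic_prefactor n l a q =
     qpoch (q powi (int n - int l) * a) q (int l) / qpoch (q powi (2 * int n - int l) * a) q (int l)"

definition shifted_cubic_value :: "nat \<Rightarrow> nat \<Rightarrow> complex \<Rightarrow> complex \<Rightarrow> complex" where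
  "shifted_cubic_value n l a q =
     shifted_cubic_prefactor n l a q * (\<Sum>i\<le>l. shifted_cubic_term n l a q i)"

lemma power_int_double: "q powi (2 * int n) = (q ^ n) ^ 2"
  for q :: "'a::division_ring"
  by (metis mult.commute of_nat_mult of_nat_numeral power_int_of_nat power_mult)

lemma power_int_quadratic_exponent:
  fixes q :: "'a::field"
  assumes "q \<noteq> 0" "i \<le> l"
  shows "q powi ((int l + 2 * int n - int i) * int i) = ((q ^ n) ^ 2) ^ i * q ^ ((l - i) * i)"
proof -
  have "(int l + 2 * int n - int i) * int i = 2 * int n * int i + int ((l - i) * i)"
    using assms(2) by (simp add: of_nat_diff algebra_simps)
  then show ?thesis
    using assms(1)
    by (simp only: power_int_add power_int_mult[of q "2 * int n"] power_int_double
        power_int_of_nat simp_thms)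
qed

locale generic_complex_parameters = generic_parameters a q for a q :: complex +
  assumes a_nonzero: "a \<noteq> 0"
begin

lemma inverse_square_not_power: "1 / ((q ^ n) ^ 2 * a) * q ^ j \<noteq> 1"
proof
  assume "1 / ((q ^ n) ^ 2 * a) * q ^ j = 1"
  then have "a * q powi (2 * int n - int j) = 1"
    using q_nonzero a_nonzero
    by (simp add: power_int_diff power_int_double divide_simps split: if_splits)
  then show False using a_not_power by simp
qed

lemma powi_arguments:
  fixes n j :: nat
  defines "x \<equiv> 1 / q ^ n" and "c \<equiv> 1 / ((q ^ n) ^ 2 * a)"
  shows "q powi (int n - int j) * a = x / (c * q ^ j)"
    and "q powi (2 * int n - int j) * a = 1 / (c * q ^ j)"
    and "q powi (- 2 * int n) / a = c"
    and "q powi (1 + int j - 2 * int n) / a = c * q ^ Suc j"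
  using q_nonzero a_nonzero
  by (simp_all add: x_def c_def power_int_diff power_int_add power_int_minus power_int_double)
    (simp_all add: field_simps power2_eq_square)

lemma very_well_poised_quotient:
  fixes n i :: nat
  defines "c \<equiv> 1 / ((q ^ n) ^ 2 * a)"
  shows "(a - q powi (2 * int i - 2 * int n)) / (a - q powi (- 2 * int n))
    = (1 - c * q ^ (2 * i)) / (1 - c)"
proof -
  have "a - q powi (2 * int i - 2 * int n) = a * (1 - c * q ^ (2 * i))"
    "a - q powi (- 2 * int n) = a * (1 - c)"
    using q_nonzero a_nonzero
    by (simp_all add: c_def power_int_diff power_int_minus power_int_double)
      (simp_all add: field_simps flip: power_mult)
  then show ?thesis using a_nonzero by simp
qed

lemma shifted_cubic_term_eq_cubic_sum_value:
  fixes n m i l :: nat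
  assumes "i \<le> l" and n: "n = 3 * m + i"
  defines "x \<equiv> 1 / q ^ n" and "c \<equiv> 1 / ((q ^ n) ^ 2 * a)"
  shows "shifted_cubic_prefactor n l a q * shifted_cubic_term n l a q i
    = pair_expansion_coeff q x c l i * cubic_sum_value a q m"
proof -
  have index: "(int n + 2 * int i) div 3 = int (m + i)" "(int n - int i) div 3 = int m"
    "3 dvd (int n - int i)"
    by (simp_all add: n)
  have powers: "a powi int (m + i) * q powi ((int l + 2 * int n - int i) * int i)
      = a ^ m * (q ^ ((l - i) * i) / c ^ i)"
    unfolding power_int_quadratic_exponent[OF q_nonzero \<open>i \<le> l\<close>]
    by (simp add: c_def power_divide power_mult_distrib power_add del: of_nat_add)
  have inverses: "q powi (- int j) = 1 / q ^ j" for j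
    by (simp add: power_int_minus inverse_eq_divide)
  note arguments = powi_arguments[where n = n, folded x_def c_def]
    and quotient = very_well_poised_quotient[where n = n, folded c_def]
  have "x / (c * q ^ i) = a * q powi (int n - int i)"
    using arguments(1)[of i] by (simp add: mult.commute)
  then have nonzero: "qprod (x / (c * q ^ i)) q i \<noteq> 0"
    using a_not_power[of "int n - int i + int _"] q_nonzero
    by (auto simp: qprod_eq_0_iff power_int_add mult.assoc)
  have "c \<noteq> 0" "c * q ^ j \<noteq> 1" for j
    unfolding c_def using inverse_square_not_power q_nonzero a_nonzero by simp_all
  note coeff = pair_expansion_coeff_eq[OF q_nonzero this \<open>i \<le> l\<close> qprod_nonzero(1) nonzero]
  show ?thesis
    unfolding shifted_cubic_prefactor_def shifted_cubic_term_def
      index powers quotient arguments inverses qpoch_of_nat coeff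
    using index by (simp add: chi_def cubic_sum_value_def mult_ac flip: x_def)
qed

lemma shifted_cubic_term_eq_cubic_sum:
  fixes n i l :: nat
  assumes "i \<le> l"
  defines "x \<equiv> 1 / q ^ n" and "c \<equiv> 1 / ((q ^ n) ^ 2 * a)"
  shows "shifted_cubic_prefactor n l a q * shifted_cubic_term n l a q i
    = pair_expansion_coeff q x c l i * cubic_sum n a q (x * q ^ i)"
proof (cases "i \<le> n")
  case True
  then have "x * q ^ i = 1 / q ^ (n - i)"
    using q_nonzero by (simp add: x_def power_diff)
  then have cubic: "cubic_sum n a q (x * q ^ i)
      = (if 3 dvd (n - i) then cubic_sum_value a q ((n - i) div 3) else 0)"
    using cubic_sum_inverse_power[of "n - i" n] by simp
  show ?thesis
  proof (cases "3 dvd (n - i)")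
    case dvd: True
    then obtain m where n: "n = 3 * m + i" using True by (metis dvdE le_add_diff_inverse2)
    then have "cubic_sum n a q (x * q ^ i) = cubic_sum_value a q m" using cubic by simp
    then show ?thesis
      using shifted_cubic_term_eq_cubic_sum_value[OF assms(1) n] by (simp add: x_def c_def)
  next
    case False
    moreover have "int n - int i = int (n - i)" using True by simp
    ultimately have "\<not> 3 dvd (int n - int i)" by presburger
    then show ?thesis using False by (simp add: cubic shifted_cubic_term_def chi_def)
  qed
next
  case False
  then have "qprod x q i = 0" "qpoch (q powi (- int n)) q (int i) = 0"
    using qprod_inverse_power_eq_0[of q n i] q_nonzero
    by (simp_all add: x_def qpoch_of_nat power_int_minus inverse_eq_divide)
  then show ?thesis by (simp add: shifted_cubic_term_def pair_expansion_coeff_def)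
qed

lemma shifted_cubic_sum_eq_value: "shifted_cubic_sum n l a q = shifted_cubic_value n l a q"
proof -
  define x c where "x = 1 / q ^ n" and "c = 1 / ((q ^ n) ^ 2 * a)"
  define pair where "pair i k = qprod (x * q ^ i) q k * qprod (x / (c * q ^ i)) q k" for i k
  have c: "c \<noteq> 0" "c * q ^ j \<noteq> 1" for j
    unfolding c_def using inverse_square_not_power q_nonzero a_nonzero by simp_all
  have partner: "x / (c * q ^ i) = a / (x * q ^ i)" for i
    using q_nonzero by (simp add: x_def c_def power2_eq_square)
  have "shifted_cubic_sum n l a q
      = (\<Sum>k\<le>n. cubic_weight a q k * (qprod x q k * qprod (x / (c * q ^ l)) q k))"
    unfolding shifted_cubic_sum_def powi_arguments(1) x_def c_def ..
  also have "\<dots> = (\<Sum>k\<le>n. \<Sum>i\<le>l. pair_expansion_coeff q x c l i * (cubic_weight a q k * pair i k))"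
    unfolding qprod_pair_expansion[OF q_nonzero c] pair_def
    by (simp add: sum_distrib_left mult_ac)
  also have "\<dots> = (\<Sum>i\<le>l. pair_expansion_coeff q x c l i * cubic_sum n a q (x * q ^ i))"
    unfolding cubic_sum_def pair_def partner sum_distrib_left by (rule sum.swap)
  also have "\<dots> = shifted_cubic_value n l a q"
    unfolding shifted_cubic_value_def sum_distrib_left x_def c_def
    by (rule sum.cong) (simp_all add: shifted_cubic_term_eq_cubic_sum)
  finally show ?thesis .
qed

end

subsection \<open>Continuity in \<open>q\<close>\<close>

lemma tendsto_qprod [tendsto_intros]:
  fixes x q :: "'b \<Rightarrow> 'a::real_normed_field"
  assumes "(x \<longlongrightarrow> x0) F" "(q \<longlongrightarrow> q0) F"
  shows "((\<lambda>t. qprod (x t) (q t) k) \<longlongrightarrow> qprod x0 q0 k) F"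
  unfolding qprod_def by (intro tendsto_intros assms)

lemma tendsto_qpoch:
  assumes "(x \<longlongrightarrow> x0) F" "(q \<longlongrightarrow> q0) F" "q0 \<noteq> 0" "qpoch_defined x0 q0 m"
  shows "((\<lambda>t. qpoch (x t) (q t) m) \<longlongrightarrow> qpoch x0 q0 m) F"
proof (cases "m \<ge> 0")
  case True
  then show ?thesis unfolding qpoch_def using assms by (auto intro!: tendsto_intros)
next
  case False
  have "(\<Prod>j\<in>{m..<0}. 1 - x0 * q0 powi j) \<noteq> 0"
    using assms(4) by (simp add: qpoch_defined_def)
  then show ?thesis unfolding qpoch_def using assms False by (auto intro!: tendsto_intros)
qed

lemma qpoch_defined_of_nat: "qpoch_defined x q (int k)"
  by (simp add: qpoch_defined_def)

lemma isCont_shifted_cubic_sum: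
  assumes "q \<noteq> 0" "\<And>k. k \<le> n \<Longrightarrow> qprod q q k \<noteq> 0 \<and> qprod a q (2 * k) \<noteq> 0"
  shows "isCont (shifted_cubic_sum n l a) q"
  unfolding isCont_def shifted_cubic_sum_def cubic_weight_def using assms
  by (intro tendsto_intros) auto

lemma isCont_shifted_cubic_prefactor:
  assumes "q \<noteq> 0" "qpoch (q powi (2 * int n - int l) * a) q (int l) \<noteq> 0"
  shows "isCont (shifted_cubic_prefactor n l a) q"
  unfolding isCont_def shifted_cubic_prefactor_def using assms
  by (intro tendsto_intros tendsto_qpoch qpoch_defined_of_nat) auto

lemma isCont_shifted_cubic_term:
  assumes "a \<noteq> 0" "q \<noteq> 0"
    and nonzero: "3 dvd (int n - int i) \<Longrightarrow>
           a - q powi (- 2 * int n) \<noteq> 0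
         \<and> qpoch q q (int i) \<noteq> 0
         \<and> qpoch (q powi (1 + int l - 2 * int n) / a) q (int i) \<noteq> 0
         \<and> qpoch (q powi (int n - int i) * a) q (int i) \<noteq> 0
         \<and> qpoch_defined q (q ^ 3) ((int n - int i) div 3)
         \<and> qpoch_defined (q ^ 2) (q ^ 3) ((int n - int i) div 3)
         \<and> qpoch_defined (q * a) (q ^ 3) ((int n - int i) div 3)
         \<and> qpoch_defined (q ^ 2 * a) (q ^ 3) ((int n - int i) div 3)
         \<and> qpoch (q * a) (q ^ 3) ((int n - int i) div 3) \<noteq> 0
         \<and> qpoch (q ^ 2 * a) (q ^ 3) ((int n - int i) div 3) \<noteq> 0"
  shows "isCont (\<lambda>q. shifted_cubic_term n l a q i) q"
proof (cases "3 dvd (int n - int i)")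
  case True
  show ?thesis unfolding isCont_def shifted_cubic_term_def using assms(1,2) nonzero[OF True]
    by (intro tendsto_intros tendsto_qpoch qpoch_defined_of_nat) auto
qed (simp add: shifted_cubic_term_def chi_def)

lemma isCont_shifted_cubic_value:
  assumes "isCont (shifted_cubic_prefactor n l a) q"
    and "\<And>i. i \<le> l \<Longrightarrow> isCont (\<lambda>q. shifted_cubic_term n l a q i) q"
  shows "isCont (shifted_cubic_value n l a) q"
  using assms unfolding isCont_def shifted_cubic_value_def by (intro tendsto_intros) auto

lemma isCont_eq_if_eq_off_countable:
  fixes f g :: "'a::euclidean_space \<Rightarrow> 'b::real_normed_vector"
  assumes "isCont f z" "isCont g z" "countable {w. f w \<noteq> g w}"
  shows "f z = g z"
proof (rule ccontr)
  assume "f z \<noteq> g z"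
  then obtain \<epsilon> where "\<epsilon> > 0" and separated: "\<And>w. dist z w < \<epsilon> \<Longrightarrow> f w - g w \<noteq> 0"
    using continuous_at_avoid[OF isCont_diff[OF assms(1,2)], of 0] by auto
  moreover have "ball z \<epsilon> - {w. f w \<noteq> g w} \<noteq> {}"
    using assms(3) \<open>\<epsilon> > 0\<close> by (rule ball_minus_countable_nonempty)
  ultimately show False by auto
qed

lemma countable_not_generic_complex_parameters:
  fixes a :: complex
  assumes "a \<noteq> 0" "a \<noteq> 1"
  shows "countable {q. \<not> generic_complex_parameters a q}"
proof -
  define exceptional where
    "exceptional = insert 0 (\<Union>k. {q. q ^ Suc k = 1} \<union> {q. q ^ Suc k = a} \<union> {q. q ^ Suc k = 1 / a})"
  have "a * q powi j \<noteq> 1" if "q \<notin> exceptional" for q j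
  proof
    assume resonance: "a * q powi j = 1"
    obtain k where "j = 0 \<or> j = int (Suc k) \<or> j = - int (Suc k)"
      by (metis int_cases3 not0_implies_Suc of_nat_0_less_iff less_irrefl)
    with resonance assms have "q ^ Suc k = 1 / a \<or> q ^ Suc k = a"
      by (auto simp: power_int_minus field_simps simp del: power_Suc of_nat_Suc)
    then show False using that by (auto simp: exceptional_def)
  qed
  then have "{q. \<not> generic_complex_parameters a q} \<subseteq> exceptional"
    using assms
    by (auto simp: generic_complex_parameters_def generic_parameters_def
        generic_complex_parameters_axioms_def exceptional_def)
  moreover have "countable exceptional"
    unfolding exceptional_def
    by (intro countable_insert countable_UN countable_Un)
      (auto intro!: countable_finite simp del: power_Suc)
  ultimately show ?thesis by (rule countable_subset)
qed

lemma sum_sqrt_eq_shifted_cubic_sum: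
  assumes "sqrt_a ^ 2 = a" "sqrt_qa ^ 2 = q * a"
  shows "(\<Sum>k=0..n.
        qpoch a (q ^ 3) (int k)
        * ((qpoch (q powi (- int n)) q (int k) * qpoch (q powi (int n - int l) * a) q (int k))
           / (qpoch q q (int k) * qpoch sqrt_a q (int k) * qpoch (- sqrt_a) q (int k)
              * qpoch sqrt_qa q (int k) * qpoch (- sqrt_qa) q (int k)))
        * q ^ k) = shifted_cubic_sum n l a q"
  unfolding shifted_cubic_sum_def cubic_weight_def atLeast0AtMost qpoch_of_nat
    qprod_square_roots[OF assms, symmetric]
  by (simp add: power_int_minus inverse_eq_divide mult_ac)

theorem theorem1:
  fixes l n :: nat and a q sqrt_a sqrt_qa :: complex
  assumes "a \<noteq> 0" and "q \<noteq> 0"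
    and "sqrt_a ^ 2 = a" and "sqrt_qa ^ 2 = q * a"
    and lhs_denominators:
      "\<forall>k\<in>{0..n}. qpoch q q (int k) \<noteq> 0
         \<and> qpoch sqrt_a q (int k) \<noteq> 0 \<and> qpoch (- sqrt_a) q (int k) \<noteq> 0
         \<and> qpoch sqrt_qa q (int k) \<noteq> 0 \<and> qpoch (- sqrt_qa) q (int k) \<noteq> 0"
    and rhs_prefactor_denominator:
      "qpoch (q powi (2 * int n - int l) * a) q (int l) \<noteq> 0"
    and rhs_denominators:
      "\<forall>i\<in>{0..l}. 3 dvd (int n - int i) \<longrightarrow>
           a - q powi (- 2 * int n) \<noteq> 0
         \<and> qpoch q q (int i) \<noteq> 0
         \<and> qpoch (q powi (1 + int l - 2 * int n) / a) q (int i) \<noteq> 0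
         \<and> qpoch (q powi (int n - int i) * a) q (int i) \<noteq> 0
         \<and> qpoch_defined q (q ^ 3) ((int n - int i) div 3)
         \<and> qpoch_defined (q ^ 2) (q ^ 3) ((int n - int i) div 3)
         \<and> qpoch_defined (q * a) (q ^ 3) ((int n - int i) div 3)
         \<and> qpoch_defined (q ^ 2 * a) (q ^ 3) ((int n - int i) div 3)
         \<and> qpoch (q * a) (q ^ 3) ((int n - int i) div 3) \<noteq> 0
         \<and> qpoch (q ^ 2 * a) (q ^ 3) ((int n - int i) div 3) \<noteq> 0"
  shows
    "(\<Sum>k=0..n.
        qpoch a (q ^ 3) (int k)
        * ((qpoch (q powi (- int n)) q (int k) * qpoch (q powi (int n - int l) * a) q (int k))
           / (qpoch q q (int k) * qpoch sqrt_a q (int k) * qpoch (- sqrt_a) q (int k)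
              * qpoch sqrt_qa q (int k) * qpoch (- sqrt_qa) q (int k)))
        * q ^ k)
     = qpoch (q powi (int n - int l) * a) q (int l)
         / qpoch (q powi (2 * int n - int l) * a) q (int l)
       * (\<Sum>i=0..l.
           a powi ((int n + 2 * int i) div 3)
           * q powi ((int l + 2 * int n - int i) * int i)
           * ((a - q powi (2 * int i - 2 * int n)) / (a - q powi (- 2 * int n)))
           * ((qpoch (q powi (- int l)) q (int i) * qpoch (q powi (- int n)) q (int i)
               * qpoch (q powi (- 2 * int n) / a) q (int i))
              / (qpoch q q (int i) * qpoch (q powi (1 + int l - 2 * int n) / a) q (int i)
                 * qpoch (q powi (int n - int i) * a) q (int i)))
           * ((qpoch q (q ^ 3) ((int n - int i) div 3)
               * qpoch (q ^ 2) (q ^ 3) ((int n - int i) div 3))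
              / (qpoch (q * a) (q ^ 3) ((int n - int i) div 3)
                 * qpoch (q ^ 2 * a) (q ^ 3) ((int n - int i) div 3)))
           * chi (int n - int i))"
proof -
  have nonzero: "qprod q q k \<noteq> 0 \<and> qprod a q (2 * k) \<noteq> 0" if "k \<le> n" for k
    unfolding qprod_square_roots[OF assms(3,4), symmetric]
    using lhs_denominators that by (simp add: qpoch_of_nat)
  have "a \<noteq> 1"
    using bspec[OF rhs_denominators, of 0] nonzero[of 1]
    by (cases n) (auto simp: numeral_2_eq_2 qprod_Suc)
  have "shifted_cubic_sum n l a q = shifted_cubic_value n l a q"
  proof (rule isCont_eq_if_eq_off_countable[where z = q])
    show "isCont (shifted_cubic_sum n l a) q"
      by (rule isCont_shifted_cubic_sum[OF \<open>q \<noteq> 0\<close> nonzero])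
    show "isCont (shifted_cubic_value n l a) q"
      using assms
      by (intro isCont_shifted_cubic_value isCont_shifted_cubic_prefactor isCont_shifted_cubic_term)
        auto
    show "countable {q. shifted_cubic_sum n l a q \<noteq> shifted_cubic_value n l a q}"
      using countable_not_generic_complex_parameters[OF \<open>a \<noteq> 0\<close> \<open>a \<noteq> 1\<close>]
      by (rule countable_subset [rotated])
        (auto dest: generic_complex_parameters.shifted_cubic_sum_eq_value)
  qed
  then show ?thesis
    unfolding sum_sqrt_eq_shifted_cubic_sum[OF assms(3,4)]
    by (simp only: shifted_cubic_value_def shifted_cubic_prefactor_def shifted_cubic_term_def
        atLeast0AtMost)
qed

end
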